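(* Let $(M,d)$ be a compact metric space, $\tilde M=M^{\mathbb Z}$ and $\sigma\colon\tilde M\to\tilde M$ the shift homeomorphism. Let $\mathrm{Sh}_\sigma\colon\tilde M^{\mathbb Z}\to\tilde M$ be given by $(\mathrm{Sh}_\sigma(\alpha))_i=(\alpha_i)_0$. The following statements are equivalent: (1) there is $\delta>0$ such that $\mathrm{Sh}_\sigma(\sigma(\alpha))=\sigma(\mathrm{Sh}_\sigma(\alpha))$ for all $\alpha\in\tilde M^{\mathbb Z}(\sigma,\delta)$; (2) $M$ is finite; (3) $\sigma$ is expansive.
   Context: $(\sigma(x))_i=x_{i+1}$ for $x\in\tilde M$. On $\tilde M^{\mathbb Z}$, $\sigma$ acts coordinatewise: $(\sigma(\alpha))_i=\sigma(\alpha_i)$, so $((\sigma(\alpha))_i)_j=(\alpha_i)_{j+1}$. Fix $\mu\in(0,1)$ and equip $\tilde M$ with $\tilde d_s(x,y)=\sum_{i\in\mathbb Z}\mu^{|i|}d(x_i,y_i)$, which induces the product topology. For $\delta>0$, $\tilde M^{\mathbb Z}(\sigma,\delta)=\{\alpha\in\tilde M^{\mathbb Z}:\tilde d_s(\sigma(\alpha_i),\alpha_{i+1})\le\delta\ \forall i\in\mathbb Z\}$. $\sigma$ is expansive if there is $\xi>0$ such that $x\ne y$ in $\tilde M$ implies $\tilde d_s(\sigma^i(x),\sigma^i(y))>\xi$ for some $i\in\mathbb Z$. *)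

theory Defs
  imports "HOL-Analysis.Analysis"
begin

definition biseqs :: "'a set \<Rightarrow> (int \<Rightarrow> 'a) set" where
  "biseqs X = {x. \<forall>i. x i \<in> X}"

definition shift :: "(int \<Rightarrow> 'a) \<Rightarrow> int \<Rightarrow> 'a" where
  "shift x = (\<lambda>i. x (i + 1))"

(* If d is bounded on the set of values of x and y, as it is on a compact space,
   the family is summable and infsum is the honest sum. *)
definition biseq_dist :: "('a \<Rightarrow> 'a \<Rightarrow> real) \<Rightarrow> real \<Rightarrow> (int \<Rightarrow> 'a) \<Rightarrow> (int \<Rightarrow> 'a) \<Rightarrow> real" where
  "biseq_dist d \<mu> x y = (\<Sum>\<^sub>\<infinity>i. \<mu> ^ nat \<bar>i\<bar> * d (x i) (y i))"

definition pseudo_orbits ::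
    "'x set \<Rightarrow> ('x \<Rightarrow> 'x \<Rightarrow> real) \<Rightarrow> ('x \<Rightarrow> 'x) \<Rightarrow> real \<Rightarrow> (int \<Rightarrow> 'x) set" where
  "pseudo_orbits X \<rho> f \<delta> = {\<alpha> \<in> biseqs X. \<forall>i. \<rho> (f (\<alpha> i)) (\<alpha> (i + 1)) \<le> \<delta>}"

(* The inverse is that of f as a map from X to X. *)
definition int_iterate :: "'x set \<Rightarrow> ('x \<Rightarrow> 'x) \<Rightarrow> int \<Rightarrow> 'x \<Rightarrow> 'x" where
  "int_iterate X f i = (if 0 \<le> i then f ^^ nat i else inv_into X f ^^ nat (- i))"

definition expansive :: "'x set \<Rightarrow> ('x \<Rightarrow> 'x \<Rightarrow> real) \<Rightarrow> ('x \<Rightarrow> 'x) \<Rightarrow> bool" where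
  "expansive X \<rho> f \<longleftrightarrow>
     (\<exists>\<xi>>0. \<forall>x\<in>X. \<forall>y\<in>X. x \<noteq> y \<longrightarrow>
        (\<exists>i. \<rho> (int_iterate X f i x) (int_iterate X f i y) > \<xi>))"

definition Sh :: "(int \<Rightarrow> int \<Rightarrow> 'a) \<Rightarrow> int \<Rightarrow> 'a" where
  "Sh \<alpha> = (\<lambda>i. \<alpha> i 0)"

lemma bij_betw_shift: "bij_betw shift (biseqs X) (biseqs X)"
  by (rule bij_betw_byWitness[where f' = "\<lambda>x i. x (i - 1)"])
     (auto simp: shift_def biseqs_def)

lemma int_iterate_shift:
  assumes "x \<in> biseqs X"
  shows "int_iterate (biseqs X) shift i x = (\<lambda>j. x (j + i))"
proof -
  have inv: "inv_into (biseqs X) shift y = (\<lambda>j. y (j - 1))" if "y \<in> biseqs X" for y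
    by (rule inv_into_f_eq[OF bij_betw_imp_inj_on[OF bij_betw_shift]])
       (use that in \<open>auto simp: shift_def biseqs_def\<close>)
  have fwd: "(shift ^^ n) x = (\<lambda>j. x (j + int n))" for n
    by (induction n) (auto simp: shift_def algebra_simps)
  have bwd: "(inv_into (biseqs X) shift ^^ n) x = (\<lambda>j. x (j - int n))" for n
  proof (induction n)
    case (Suc n)
    have "(\<lambda>j. x (j - int n)) \<in> biseqs X"
      using assms by (auto simp: biseqs_def)
    then show ?case using Suc by (simp add: inv algebra_simps)
  qed simp
  show ?thesis by (auto simp: int_iterate_def fwd bwd)
qed

end

theory Submission
  imports Defs
begin

text \<open>
  Unfolding the definitions, the commutation in (1) says that the coordinate-zero entry of
  \<open>shift (\<alpha> i)\<close> equals that of \<open>\<alpha> (i + 1)\<close>. All three conditions turn out to say that the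
  points of \<open>M\<close> are uniformly separated, which for a compact space means that it is finite.

  If \<open>M\<close> is finite, let \<open>m\<close> be a positive lower bound for the distances of distinct points. The
  distance of two sequences dominates the distance of their entries at zero
  (\<open>dist_at_zero_le_biseq_dist\<close>), so sequences at distance below \<open>m\<close> agree there. Applied to
  successive members of a pseudo-orbit this is (1); and two distinct sequences can be shifted so
  that they disagree at zero, which gives expansivity.

  If \<open>M\<close> is infinite, total boundedness yields distinct points \<open>a\<close>, \<open>b\<close> as close as desired, and
  the constant sequences at \<open>a\<close> and at \<open>b\<close> are then just as close up to the fixed factor
  \<open>\<Sum>\<^sub>\<infinity>i. \<mu> ^ nat \<bar>i\<bar>\<close> (\<open>close_constant_biseqs\<close>). Both are fixed by the shift. Hence their orbits
  stay close, against expansivity, and jumping once from the first to the second is a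
  pseudo-orbit that violates (1).
\<close>

lemma summable_on_two_sided_geometric:
  fixes \<mu> :: real
  assumes "0 < \<mu>" and "\<mu> < 1"
  shows "(\<lambda>i::int. \<mu> ^ nat \<bar>i\<bar>) summable_on UNIV"
proof -
  let ?f = "\<lambda>i::int. \<mu> ^ nat \<bar>i\<bar>"
  have geometric: "(\<lambda>n. \<mu> ^ n) summable_on UNIV"
    by (rule summable_nonneg_imp_summable_on) (use assms in \<open>auto intro: summable_geometric\<close>)
  have "?f summable_on range int"
    by (subst summable_on_reindex) (use geometric in \<open>auto simp: o_def\<close>)
  moreover have "?f summable_on range (\<lambda>n. - int n)"
    by (subst summable_on_reindex) (use geometric in \<open>auto simp: o_def inj_on_def\<close>)
  ultimately have "?f summable_on (range int \<union> range (\<lambda>n. - int n))"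
    using assms by (intro summable_on_union) auto
  moreover have "range int \<union> range (\<lambda>n. - int n) = UNIV"
    by (auto simp: image_iff) (metis int_cases2)
  ultimately show ?thesis by simp
qed

text \<open>The term of index zero carries weight one, and no term is negative.\<close>

lemma (in Metric_space) dist_at_zero_le_biseq_dist:
  assumes "mbounded M" and "0 < \<mu>" and "\<mu> < 1" and "x \<in> biseqs M" and "y \<in> biseqs M"
  shows "d (x 0) (y 0) \<le> biseq_dist d \<mu> x y"
proof -
  let ?f = "\<lambda>i::int. \<mu> ^ nat \<bar>i\<bar> * d (x i) (y i)"
  obtain B where B: "d u v \<le> B" if "u \<in> M" "v \<in> M" for u v
    using assms(1) unfolding mbounded_alt by blast
  have "(\<lambda>i::int. \<mu> ^ nat \<bar>i\<bar> * B) summable_on UNIV"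
    by (intro summable_on_cmult_left summable_on_two_sided_geometric assms)
  then have "?f summable_on UNIV"
    by (rule summable_on_comparison_test)
       (use assms B in \<open>auto simp: biseqs_def intro!: mult_left_mono\<close>)
  then have "infsum ?f {0} \<le> infsum ?f UNIV"
    by (intro infsum_mono2) (use assms in auto)
  then show ?thesis by (simp add: biseq_dist_def)
qed

lemma biseq_dist_const:
  "biseq_dist d \<mu> (\<lambda>_. a) (\<lambda>_. b) = (\<Sum>\<^sub>\<infinity>i::int. \<mu> ^ nat \<bar>i\<bar>) * d a b"
  by (simp add: biseq_dist_def infsum_cmult_left')

lemma (in Metric_space) finite_imp_uniformly_separated:
  assumes "finite M"
  obtains m where "0 < m" and "\<And>a b. a \<in> M \<Longrightarrow> b \<in> M \<Longrightarrow> a \<noteq> b \<Longrightarrow> m \<le> d a b"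
proof -
  \<comment> \<open>The extra element 1 makes the minimum meaningful when there are no two distinct points.\<close>
  define D where "D = insert 1 ((\<lambda>(a, b). d a b) ` {(a, b) \<in> M \<times> M. a \<noteq> b})"
  have "finite {(a, b) \<in> M \<times> M. a \<noteq> b}"
    by (rule finite_subset[of _ "M \<times> M"]) (use assms in auto)
  then have fin: "finite D"
    by (simp add: D_def)
  have pos: "0 < Min D"
    using fin by (subst Min_gr_iff) (auto simp: D_def)
  have "Min D \<le> d a b" if "a \<in> M" "b \<in> M" "a \<noteq> b" for a b
    by (rule Min_le[OF fin]) (use that in \<open>auto simp: D_def\<close>)
  with pos show thesis by (rule that)
qed

text \<open>Finitely many balls of radius \<open>\<epsilon> / 2\<close> cover an infinite space, so one of them contains two
  distinct points.\<close>

lemma (in Metric_space) infinite_totally_bounded_imp_close_points: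
  assumes "mtotally_bounded M" and "infinite M" and "0 < \<epsilon>"
  obtains a b where "a \<in> M" and "b \<in> M" and "a \<noteq> b" and "d a b < \<epsilon>"
proof -
  obtain K where K: "finite K" "M \<subseteq> (\<Union>x\<in>K. mball x (\<epsilon> / 2))"
    using assms(1,3) unfolding mtotally_bounded_def by (meson half_gt_zero)
  have "\<exists>x\<in>K. infinite (M \<inter> mball x (\<epsilon> / 2))"
  proof (rule ccontr)
    assume "\<not> (\<exists>x\<in>K. infinite (M \<inter> mball x (\<epsilon> / 2)))"
    then have "finite (\<Union>x\<in>K. M \<inter> mball x (\<epsilon> / 2))"
      using K(1) by blast
    moreover have "M \<subseteq> (\<Union>x\<in>K. M \<inter> mball x (\<epsilon> / 2))"
      using K(2) by blast
    ultimately show False using assms(2) finite_subset by blast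
  qed
  then obtain x where inf: "infinite (M \<inter> mball x (\<epsilon> / 2))" by blast
  then obtain a where a: "a \<in> M \<inter> mball x (\<epsilon> / 2)"
    using infinite_imp_nonempty by blast
  obtain b where b: "b \<in> M \<inter> mball x (\<epsilon> / 2) - {a}"
    using infinite_imp_nonempty[OF infinite_remove[OF inf]] by blast
  have "d a b \<le> d x a + d x b"
    using a b triangle[of a x b] commute[of x a] by auto
  also have "\<dots> < \<epsilon>" using a b by auto
  finally show thesis using a b that by blast
qed

lemma (in Metric_space) close_constant_biseqs:
  assumes "mtotally_bounded M" and "infinite M" and "0 < \<mu>" and "0 < \<epsilon>"
  obtains a b where "a \<in> M" and "b \<in> M" and "a \<noteq> b"
    and "biseq_dist d \<mu> (\<lambda>_. a) (\<lambda>_. b) \<le> \<epsilon>"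
proof -
  define C where "C = (\<Sum>\<^sub>\<infinity>i::int. \<mu> ^ nat \<bar>i\<bar>)"
  have C: "0 \<le> C" unfolding C_def using assms(3) by (intro infsum_nonneg) auto
  then have "0 < \<epsilon> / (C + 1)" using assms(4) by simp
  then obtain a b where ab: "a \<in> M" "b \<in> M" "a \<noteq> b" "d a b < \<epsilon> / (C + 1)"
    using infinite_totally_bounded_imp_close_points[OF assms(1,2)] by blast
  have "C * d a b \<le> (C + 1) * d a b"
    by (simp add: distrib_right)
  also have "\<dots> \<le> \<epsilon>"
    using ab(4) C by (simp add: field_simps)
  finally show thesis
    using that ab by (simp add: biseq_dist_const C_def)
qed

lemma Sh_commutes_iff:
  "Sh (\<lambda>i. shift (\<alpha> i)) = shift (Sh \<alpha>) \<longleftrightarrow> (\<forall>i. shift (\<alpha> i) 0 = \<alpha> (i + 1) 0)"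
  by (auto simp: Sh_def shift_def fun_eq_iff)

lemma shift_const [simp]: "shift (\<lambda>_. a) = (\<lambda>_. a)"
  by (simp add: shift_def)

lemma shift_in_biseqs: "x \<in> biseqs X \<Longrightarrow> shift x \<in> biseqs X"
  by (simp add: shift_def biseqs_def)

theorem proposition6p7:
  fixes M :: "'a set" and d :: "'a \<Rightarrow> 'a \<Rightarrow> real" and \<mu> :: real
  assumes "Metric_space M d"
    and "compact_space (Metric_space.mtopology M d)"
    and "0 < \<mu>" and "\<mu> < 1"
  shows "((\<exists>\<delta>>0. \<forall>\<alpha> \<in> pseudo_orbits (biseqs M) (biseq_dist d \<mu>) shift \<delta>.
              Sh (\<lambda>i. shift (\<alpha> i)) = shift (Sh \<alpha>))
            \<longleftrightarrow> finite M) \<and>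
         (finite M \<longleftrightarrow> expansive (biseqs M) (biseq_dist d \<mu>) shift)"
    (is "(?commutes \<longleftrightarrow> finite M) \<and> (finite M \<longleftrightarrow> ?expansive)")
proof -
  interpret Metric_space M d by fact
  have tb: "mtotally_bounded M"
    using assms(2) by (simp add: compact_space_eq_mcomplete_mtotally_bounded)
  note at_zero = dist_at_zero_le_biseq_dist[OF mtotally_bounded_imp_mbounded[OF tb] assms(3,4)]
  have "?commutes \<and> ?expansive" if fin: "finite M"
  proof -
    obtain m where m: "0 < m" "\<And>a b. a \<in> M \<Longrightarrow> b \<in> M \<Longrightarrow> a \<noteq> b \<Longrightarrow> m \<le> d a b"
      using finite_imp_uniformly_separated[OF fin] by blast
    have separated: "m / 2 < biseq_dist d \<mu> x y"
      if "x \<in> biseqs M" "y \<in> biseqs M" "x 0 \<noteq> y 0" for x y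
    proof -
      have "m \<le> d (x 0) (y 0)"
        using that by (intro m(2)) (auto simp: biseqs_def)
      also have "\<dots> \<le> biseq_dist d \<mu> x y"
        using that by (intro at_zero)
      finally show ?thesis using m(1) by linarith
    qed
    have "Sh (\<lambda>i. shift (\<alpha> i)) = shift (Sh \<alpha>)"
      if \<alpha>: "\<alpha> \<in> pseudo_orbits (biseqs M) (biseq_dist d \<mu>) shift (m / 2)" for \<alpha>
      unfolding Sh_commutes_iff
    proof (intro allI, rule ccontr)
      fix i
      assume neq: "shift (\<alpha> i) 0 \<noteq> \<alpha> (i + 1) 0"
      have mem: "\<alpha> j \<in> biseqs M" for j
        using \<alpha> by (simp add: pseudo_orbits_def biseqs_def)
      have "m / 2 < biseq_dist d \<mu> (shift (\<alpha> i)) (\<alpha> (i + 1))"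
        using shift_in_biseqs[OF mem] mem neq by (rule separated)
      moreover have "biseq_dist d \<mu> (shift (\<alpha> i)) (\<alpha> (i + 1)) \<le> m / 2"
        using \<alpha> by (simp add: pseudo_orbits_def)
      ultimately show False by simp
    qed
    then have ?commutes using m(1) by (intro exI[of _ "m / 2"]) auto
    moreover have "\<exists>i. m / 2 < biseq_dist d \<mu> (int_iterate (biseqs M) shift i x)
                                 (int_iterate (biseqs M) shift i y)"
      if xy: "x \<in> biseqs M" "y \<in> biseqs M" "x \<noteq> y" for x y
    proof -
      obtain i where i: "x i \<noteq> y i" using xy(3) by blast
      have "m / 2 < biseq_dist d \<mu> (\<lambda>j. x (j + i)) (\<lambda>j. y (j + i))"
        using xy i by (intro separated) (auto simp: biseqs_def)
      then show ?thesis using xy by (auto simp: int_iterate_shift)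
    qed
    then have ?expansive using m(1) unfolding expansive_def
      by (intro exI[of _ "m / 2"]) auto
    ultimately show ?thesis by blast
  qed
  moreover have "\<not> ?commutes" if inf: "infinite M"
  proof
    assume ?commutes
    then obtain \<delta> where \<delta>: "0 < \<delta>"
      "\<And>\<alpha>. \<alpha> \<in> pseudo_orbits (biseqs M) (biseq_dist d \<mu>) shift \<delta> \<Longrightarrow>
        Sh (\<lambda>i. shift (\<alpha> i)) = shift (Sh \<alpha>)" by blast
    obtain a b where ab: "a \<in> M" "b \<in> M" "a \<noteq> b"
      "biseq_dist d \<mu> (\<lambda>_. a) (\<lambda>_. b) \<le> \<delta>"
      using close_constant_biseqs[OF tb inf assms(3) \<delta>(1)] by blast
    define \<alpha> :: "int \<Rightarrow> int \<Rightarrow> 'a" where "\<alpha> i = (\<lambda>_. if i \<le> 0 then a else b)" for i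
    have "biseq_dist d \<mu> (shift (\<alpha> i)) (\<alpha> (i + 1)) \<le> \<delta>" for i
    proof (cases "i = 0")
      case True
      then show ?thesis using ab(4) by (simp add: \<alpha>_def)
    next
      case False
      then have "\<alpha> (i + 1) = \<alpha> i" by (auto simp: \<alpha>_def fun_eq_iff)
      then show ?thesis using ab(1,2) \<delta>(1) by (simp add: \<alpha>_def biseq_dist_const)
    qed
    moreover have "\<alpha> \<in> biseqs (biseqs M)" using ab by (auto simp: biseqs_def \<alpha>_def)
    ultimately have "Sh (\<lambda>i. shift (\<alpha> i)) = shift (Sh \<alpha>)"
      by (intro \<delta>(2)) (auto simp: pseudo_orbits_def)
    then have "shift (\<alpha> 0) 0 = \<alpha> (0 + 1) 0" unfolding Sh_commutes_iff by blast
    then show False using ab(3) by (simp add: \<alpha>_def)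
  qed
  moreover have "\<not> ?expansive" if inf: "infinite M"
  proof
    assume ?expansive
    then obtain \<xi> where \<xi>: "0 < \<xi>"
      "\<And>x y. x \<in> biseqs M \<Longrightarrow> y \<in> biseqs M \<Longrightarrow> x \<noteq> y \<Longrightarrow>
        \<exists>i. \<xi> < biseq_dist d \<mu> (int_iterate (biseqs M) shift i x) (int_iterate (biseqs M) shift i y)"
      unfolding expansive_def by blast
    obtain a b where ab: "a \<in> M" "b \<in> M" "a \<noteq> b"
      "biseq_dist d \<mu> (\<lambda>_. a) (\<lambda>_. b) \<le> \<xi>"
      using close_constant_biseqs[OF tb inf assms(3) \<xi>(1)] by blast
    have mem: "(\<lambda>_. a) \<in> biseqs M" "(\<lambda>_. b) \<in> biseqs M"
      using ab by (auto simp: biseqs_def)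
    moreover have "(\<lambda>_::int. a) \<noteq> (\<lambda>_. b)" using ab(3) by (auto simp: fun_eq_iff)
    ultimately have "\<xi> < biseq_dist d \<mu> (\<lambda>_. a) (\<lambda>_. b)"
      using \<xi>(2)[OF mem] by (auto simp: int_iterate_shift)
    then show False using ab(4) by simp
  qed
  ultimately show ?thesis by blast
qed

end
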